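(* Let $f$, $U$, $k_0>0$ be as in the context, let $(c_T(t),k_T(t))$ be the unique optimal solution of the undiscounted finite horizon problem with horizon $T$, and let $(k,c)=(k^\circ,c^\circ)$ be the limit path $k^\circ(t)=\lim_{T\to\infty}k_T(t)$, $c^\circ(t)=\lim_{T\to\infty}c_T(t)$ (these limits being assumed to exist). Consider the case $U(c^\circ(t))<0$ and $U(c_1(t))<0$ for all $t$. If the following conditions (i) and (ii) are simultaneously satisfied, then for an arbitrary feasible path $(k_1,c_1)$ one has $(k_1,c_1)\le(k^\circ,c^\circ)$, that is, $$\lim_{T\to\infty}\frac{\sum_{t=0}^{T-1}U(c_1(t))+U(f(k_1(T)))}{\sum_{t=0}^{T-1}U(c^\circ(t))+U(f(k^\circ(T)))}\ge 1 .$$ Condition (i): $\lim_{T\to\infty}\sum_{t=0}^{T}U(c_T(t))$ is infinite. Condition (ii): $$\lim_{T\to\infty}\frac{\sum_{t=0}^{T-1}\bigl(U(c_T(t))-U(c^\circ(t))\bigr)+U(f(k_T(T)))-U(f(k^\circ(T)))}{\sum_{t=0}^{T}U(c_T(t))}=0.$$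
   Context: Time is discrete, $t=0,1,2,\dots$. The production function $f:\mathbb{R}_+\to\mathbb{R}_+$ is continuous, strictly increasing, weakly concave and continuously differentiable, with $f(0)=0$, and for some $\bar x>0$: $x\le f(x)\le\bar x$ if $0\le x\le\bar x$, and $f(x)<x$ if $x>\bar x$. The utility function $U:\mathbb{R}_+\to\mathbb{R}$ is continuous, strictly increasing, strictly concave and continuously differentiable. The initial capital $k_0>0$ is given. Finite horizon problem with horizon $T\in[0,\infty)$: maximize $\sum_{t=0}^{T}U(c(t))$ with $c(t)\ge 0$, $k(t+1)\ge 0$, subject to $k(t+1)=f(k(t))-c(t)$, $k(0)=k_0$, $k(T+1)=0$. Its unique solution is denoted $(c_T,k_T)$. Feasible paths (infinite horizon) are paths $(k,c)$ with $c(t)\ge 0$, $k(t+1)\ge 0$ satisfying the budget constraint $k(t+1)=f(k(t))-c(t)$, the initial condition $k(0)=k_0$, and the boundary condition that no goods should be wasted. This last condition is stated only verbally; it is incorporated by converting each feasible path, for every chosen terminal date $T$, into the path with consumption $\tilde c(t)=c(t)$ before date $T$, $\tilde c(T)=f(k(T))$, $\tilde c(t)=0$ for $t\ge T+1$, and capital $\tilde k(t)=k(t)$ for $t\le T$, $\tilde k(t)=0$ for $t\ge T+1$. Order relation (catching up / overtaking): for such converted feasible paths $(k_1,c_1)$, $(k_2,c_2)$ with $U(c_1(t))<0$ and $U(c_2(t))<0$ for all $t$, one writes $(k_1,c_1)\le(k_2,c_2)$, i.e. $(k_2,c_2)$ catches up to (overtakes) $(k_1,c_1)$, if $\displaystyle\lim_{T\to\infty}\frac{\sum_{t=0}^{T-1}U(c_1(t))+U(f(k_1(T)))}{\sum_{t=0}^{T-1}U(c_2(t))+U(f(k_2(T)))}\ge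 1$. A feasible path is optimal if it catches up to every other feasible path.
   Formalization: The limit in the order relation is taken as a limit inferior (≥ 1), since for an arbitrary feasible path the quotient need not converge (e.g. paths alternating over ever longer blocks); whenever the limit exists, this is the stated condition. *)

theory Defs
  imports "HOL-Analysis.Analysis"
begin

text \<open>
  Functions on the nonnegative half-line are total functions on the reals of which only the
  values on \<open>{0..}\<close> matter. Accordingly, derivatives are taken within \<open>{0..}\<close>, that is, one-sided
  at 0; this is why \<open>C1_differentiable_on\<close>, which uses two-sided derivatives, is not used here.
\<close>

definition C1_on_nonneg :: "(real \<Rightarrow> real) \<Rightarrow> bool" where
  "C1_on_nonneg g \<longleftrightarrow>
     (\<exists>g'. (\<forall>x\<ge>0. (g has_real_derivative g' x) (at x within {0..})) \<and> continuous_on {0..} g')"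

definition strictly_concave_on :: "real set \<Rightarrow> (real \<Rightarrow> real) \<Rightarrow> bool" where
  "strictly_concave_on S g \<longleftrightarrow> convex S \<and>
     (\<forall>x\<in>S. \<forall>y\<in>S. \<forall>u. x \<noteq> y \<and> 0 < u \<and> u < 1 \<longrightarrow>
        (1 - u) * g x + u * g y < g ((1 - u) * x + u * y))"

definition production_function :: "(real \<Rightarrow> real) \<Rightarrow> bool" where
  "production_function f \<longleftrightarrow>
     (\<forall>x\<ge>0. 0 \<le> f x) \<and>
     continuous_on {0..} f \<and> strict_mono_on {0..} f \<and> concave_on {0..} f \<and> C1_on_nonneg f \<and>
     f 0 = 0 \<and>
     (\<exists>xb>0. (\<forall>x. 0 \<le> x \<and> x \<le> xb \<longrightarrow> x \<le> f x \<and> f x \<le> xb) \<and> (\<forall>x>xb. f x < x))"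

definition utility_function :: "(real \<Rightarrow> real) \<Rightarrow> bool" where
  "utility_function U \<longleftrightarrow>
     continuous_on {0..} U \<and> strict_mono_on {0..} U \<and> strictly_concave_on {0..} U \<and> C1_on_nonneg U"

text \<open>
  Paths are sequences over all dates. For the problem with horizon \<open>T\<close> only \<open>c t\<close> with \<open>t \<le> T\<close>
  and \<open>k t\<close> with \<open>t \<le> T + 1\<close> are relevant; later values are unconstrained.
\<close>

definition finite_horizon_admissible ::
    "(real \<Rightarrow> real) \<Rightarrow> real \<Rightarrow> nat \<Rightarrow> (nat \<Rightarrow> real) \<Rightarrow> (nat \<Rightarrow> real) \<Rightarrow> bool" where
  "finite_horizon_admissible f k0 T k c \<longleftrightarrow>
     k 0 = k0 \<and> k (T + 1) = 0 \<and>
     (\<forall>t\<le>T. 0 \<le> c t \<and> 0 \<le> k (t + 1) \<and> k (t + 1) = f (k t) - c t)"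

definition finite_horizon_optimal ::
    "(real \<Rightarrow> real) \<Rightarrow> (real \<Rightarrow> real) \<Rightarrow> real \<Rightarrow> nat \<Rightarrow> (nat \<Rightarrow> real) \<Rightarrow> (nat \<Rightarrow> real) \<Rightarrow> bool" where
  "finite_horizon_optimal f U k0 T k c \<longleftrightarrow>
     finite_horizon_admissible f k0 T k c \<and>
     (\<forall>k' c'. finite_horizon_admissible f k0 T k' c' \<longrightarrow> (\<Sum>t\<le>T. U (c' t)) \<le> (\<Sum>t\<le>T. U (c t)))"

definition feasible_path ::
    "(real \<Rightarrow> real) \<Rightarrow> real \<Rightarrow> (nat \<Rightarrow> real) \<Rightarrow> (nat \<Rightarrow> real) \<Rightarrow> bool" where
  "feasible_path f k0 k c \<longleftrightarrow>
     k 0 = k0 \<and> (\<forall>t. 0 \<le> c t \<and> 0 \<le> k (t + 1) \<and> k (t + 1) = f (k t) - c t)"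

text \<open>
  The requirement that no goods be wasted is imposed by conversion: at a chosen terminal date \<open>T\<close>
  the whole output is consumed. The utility of the converted path is what the order relation
  compares.
\<close>

definition converted_consumption ::
    "(real \<Rightarrow> real) \<Rightarrow> (nat \<Rightarrow> real) \<Rightarrow> (nat \<Rightarrow> real) \<Rightarrow> nat \<Rightarrow> nat \<Rightarrow> real" where
  "converted_consumption f k c T t = (if t < T then c t else if t = T then f (k T) else 0)"

definition converted_capital :: "(nat \<Rightarrow> real) \<Rightarrow> nat \<Rightarrow> nat \<Rightarrow> real" where
  "converted_capital k T t = (if t \<le> T then k t else 0)"

definition converted_utility ::
    "(real \<Rightarrow> real) \<Rightarrow> (real \<Rightarrow> real) \<Rightarrow> (nat \<Rightarrow> real) \<Rightarrow> (nat \<Rightarrow> real) \<Rightarrow> nat \<Rightarrow> real" where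
  "converted_utility f U k c T = (\<Sum>t<T. U (c t)) + U (f (k T))"

lemma converted_utility_eq:
  "converted_utility f U k c T = (\<Sum>t\<le>T. U (converted_consumption f k c T t))"
  by (simp add: converted_utility_def converted_consumption_def flip: lessThan_Suc_atMost)

lemma converted_admissible:
  assumes "production_function f" "k0 > 0" "feasible_path f k0 k c"
  shows "finite_horizon_admissible f k0 T (converted_capital k T) (converted_consumption f k c T)"
proof -
  have "0 \<le> k t" for t
    using assms(2,3) unfolding feasible_path_def by (cases t) (simp, metis Suc_eq_plus1)
  moreover from this have "c t \<le> f (k t)" for t
    using assms(3) unfolding feasible_path_def by (metis diff_ge_0_iff_ge)
  ultimately show ?thesis
    using assms
    by (auto simp: finite_horizon_admissible_def feasible_path_def production_function_def
        converted_capital_def converted_consumption_def)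
qed

text \<open>
  \<open>catches_up f U k0 k1 c1 k2 c2\<close> says that \<open>(k2, c2)\<close> catches up to \<open>(k1, c1)\<close>. The relation
  is restricted to feasible paths with negative utilities. The quotient of utilities
  need not converge for arbitrary feasible paths, so the limit is taken as a limit inferior in the
  extended reals; when the quotient does converge (possibly to infinity), this is the plain limit.
\<close>

definition catches_up ::
    "(real \<Rightarrow> real) \<Rightarrow> (real \<Rightarrow> real) \<Rightarrow> real \<Rightarrow>
      (nat \<Rightarrow> real) \<Rightarrow> (nat \<Rightarrow> real) \<Rightarrow> (nat \<Rightarrow> real) \<Rightarrow> (nat \<Rightarrow> real) \<Rightarrow> bool" where
  "catches_up f U k0 k1 c1 k2 c2 \<longleftrightarrow>
     feasible_path f k0 k1 c1 \<and> feasible_path f k0 k2 c2 \<and>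
     (\<forall>t. U (c1 t) < 0) \<and> (\<forall>t. U (c2 t) < 0) \<and>
     1 \<le> liminf (\<lambda>T. ereal (converted_utility f U k1 c1 T / converted_utility f U k2 c2 T))"

lemma catches_up_iff_lim:
  assumes "feasible_path f k0 k1 c1" "feasible_path f k0 k2 c2"
    and "\<And>t. U (c1 t) < 0" "\<And>t. U (c2 t) < 0"
    and "(\<lambda>T. ereal (converted_utility f U k1 c1 T / converted_utility f U k2 c2 T)) \<longlonglongrightarrow> L"
  shows "catches_up f U k0 k1 c1 k2 c2 \<longleftrightarrow> 1 \<le> L"
  using assms lim_imp_Liminf[OF sequentially_bot assms(5)] by (simp add: catches_up_def)

end

theory Submission
  imports Defs
begin

text \<open>
  At its terminal date the finite-horizon optimum consumes all output, so its value \<open>W T\<close> is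
  itself a converted utility and bounds the converted utility of every feasible path. Condition (ii)
  says that the converted utility \<open>V T\<close> of the limit path satisfies \<open>V T / W T \<longlonglongrightarrow> 1\<close>. If
  \<open>W T \<longlonglongrightarrow> -\<infinity>\<close>, then dividing \<open>V1 T \<le> W T\<close> by the eventually negative \<open>V T\<close> gives
  the claim. The case \<open>W T \<longlonglongrightarrow> \<infinity>\<close> cannot occur: capital is bounded and \<open>U (c t) < 0\<close>, so \<open>V T\<close>
  is bounded above.
\<close>

text \<open>The boundary condition \<open>k (T + 1) = 0\<close>, put into the budget constraint at
  date \<open>T\<close>, forces \<open>c T = f (k T)\<close>.\<close>

lemma finite_horizon_optimal_value:
  assumes "finite_horizon_optimal f U k0 T k c"
  shows "(\<Sum>t\<le>T. U (c t)) = converted_utility f U k c T"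
proof -
  have "k (T + 1) = 0" "k (T + 1) = f (k T) - c T"
    using assms unfolding finite_horizon_optimal_def finite_horizon_admissible_def by blast+
  then have "c T = f (k T)" by simp
  then show ?thesis
    by (simp add: converted_utility_def flip: lessThan_Suc_atMost)
qed

text \<open>Conversion at date \<open>T\<close> turns any feasible path into a competitor in the
  problem with horizon \<open>T\<close>.\<close>

lemma converted_utility_le_optimal:
  assumes "production_function f" "k0 > 0" "finite_horizon_optimal f U k0 T kT cT"
    and "feasible_path f k0 k c"
  shows "converted_utility f U k c T \<le> (\<Sum>t\<le>T. U (cT t))"
  using assms(3) converted_admissible[OF assms(1,2,4), of T]
  unfolding finite_horizon_optimal_def converted_utility_eq by blast

lemma feasible_path_nonneg:
  assumes "k0 > 0" "feasible_path f k0 k c"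
  shows "0 \<le> k t"
  using assms unfolding feasible_path_def by (cases t) (simp, metis Suc_eq_plus1)

text \<open>Each constraint at a fixed date \<open>t\<close> involves finitely many coordinates and
  holds for every \<open>T \<ge> t\<close>. It survives the pointwise limit because weak
  inequalities are closed conditions and \<open>f\<close> is continuous.\<close>

lemma feasible_path_limit:
  assumes cont: "continuous_on {0..} f" and k0: "k0 > 0"
    and adm: "\<And>T. finite_horizon_admissible f k0 T (kT T) (cT T)"
    and lim_k: "\<And>t. (\<lambda>T. kT T t) \<longlonglongrightarrow> k t"
    and lim_c: "\<And>t. (\<lambda>T. cT T t) \<longlonglongrightarrow> c t"
  shows "feasible_path f k0 k c"
proof -
  have step: "0 \<le> cT T t" "0 \<le> kT T (t + 1)" "kT T (t + 1) = f (kT T t) - cT T t"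
    if "t \<le> T" for t T
    using adm[of T] that unfolding finite_horizon_admissible_def by blast+
  have init: "kT T 0 = k0" for T
    using adm[of T] unfolding finite_horizon_admissible_def by blast
  have pos: "0 \<le> kT T t" if "t \<le> T" for t T
    using that init[of T] k0 step(2)[of "t - 1" T] by (cases t) auto
  have c_nonneg: "0 \<le> c t" for t
    using step(1) by (intro LIMSEQ_le_const[OF lim_c]) blast
  have k_nonneg: "0 \<le> k t" for t
    using pos by (intro LIMSEQ_le_const[OF lim_k]) blast
  have "k 0 = k0"
    using lim_k[of 0] by (simp add: init LIMSEQ_const_iff)
  moreover have "k (t + 1) = f (k t) - c t" for t
  proof -
    \<comment> \<open>Continuity is available only on \<open>{0..}\<close>, so both the limit and
      the eventual terms must lie there; \<open>pos\<close> covers the terms with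
      \<open>T \<ge> t\<close>.\<close>
    have "(\<lambda>T. f (kT T t)) \<longlonglongrightarrow> f (k t)"
      by (rule continuous_on_tendsto_compose[OF cont lim_k])
        (use k_nonneg pos in \<open>auto intro: eventually_sequentiallyI\<close>)
    then have "(\<lambda>T. f (kT T t) - cT T t) \<longlonglongrightarrow> f (k t) - c t"
      by (intro tendsto_diff lim_c)
    moreover have "\<forall>\<^sub>F T in sequentially. f (kT T t) - cT T t = kT T (t + 1)"
      using eventually_ge_at_top[of t] by eventually_elim (simp add: step(3)[simplified])
    ultimately have "(\<lambda>T. kT T (t + 1)) \<longlonglongrightarrow> f (k t) - c t"
      by (rule Lim_transform_eventually)
    then show ?thesis
      using lim_k LIMSEQ_unique by blast
  qed
  ultimately show ?thesis
    using c_nonneg k_nonneg unfolding feasible_path_def by blast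
qed

text \<open>The interval from 0 to \<open>max k0 xb\<close> is invariant under \<open>f\<close>:
  output stays below \<open>xb\<close> up to \<open>xb\<close> and falls short of the input beyond
  it. The maximum allows for initial capital above \<open>xb\<close>.\<close>

lemma feasible_path_output_bounded:
  assumes f: "production_function f" and k0: "k0 > 0" and feas: "feasible_path f k0 k c"
  obtains M where "\<And>t. f (k t) \<le> M" "M \<ge> 0"
proof -
  obtain xb where xb: "xb > 0" "\<And>x. 0 \<le> x \<Longrightarrow> x \<le> xb \<Longrightarrow> f x \<le> xb" "\<And>x. x > xb \<Longrightarrow> f x < x"
    using f unfolding production_function_def by blast
  have f_le: "f x \<le> max k0 xb" if "0 \<le> x" "x \<le> max k0 xb" for x
    using xb(2)[of x] xb(3)[of x] that by (cases "x \<le> xb") auto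
  have "k t \<le> max k0 xb" for t
  proof (induction t)
    case 0
    then show ?case using feas by (simp add: feasible_path_def)
  next
    case (Suc t)
    have "k (Suc t) \<le> f (k t)"
      using feas unfolding feasible_path_def by (metis Suc_eq_plus1 diff_le_eq le_add_same_cancel1)
    then show ?case
      using f_le[OF feasible_path_nonneg[OF k0 feas] Suc] by linarith
  qed
  then show thesis
    using f_le feasible_path_nonneg[OF k0 feas] xb(1) by (intro that[of "max k0 xb"]) auto
qed

text \<open>Only the terminal term \<open>U (f (k T))\<close> can be positive, and bounded output
  bounds it.\<close>

lemma converted_utility_bounded_above:
  assumes f: "production_function f" and U: "utility_function U" and k0: "k0 > 0"
    and feas: "feasible_path f k0 k c" and neg: "\<And>t. U (c t) < 0"
  obtains B where "\<And>T. converted_utility f U k c T \<le> B"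
proof -
  obtain M where M: "\<And>t. f (k t) \<le> M" "M \<ge> 0"
    using feasible_path_output_bounded[OF f k0 feas] by blast
  have mono: "mono_on {0..} U"
    using U unfolding utility_function_def by (blast intro: strict_mono_on_imp_mono_on)
  show thesis
  proof (rule that[of "U M"])
    fix T
    have "0 \<le> f (k T)"
      using f feasible_path_nonneg[OF k0 feas] unfolding production_function_def by blast
    then have "U (f (k T)) \<le> U M"
      using M by (intro mono_onD[OF mono]) auto
    moreover have "(\<Sum>t<T. U (c t)) \<le> 0"
      by (intro sum_nonpos less_imp_le neg)
    ultimately show "converted_utility f U k c T \<le> U M"
      by (simp add: converted_utility_def)
  qed
qed

lemma liminf_quotient_ge_1:
  fixes V V1 W :: "nat \<Rightarrow> real"
  assumes W: "filterlim W at_bot sequentially"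
    and V: "(\<lambda>T. V T / W T) \<longlonglongrightarrow> 1"
    and le: "\<And>T. V1 T \<le> W T"
  shows "1 \<le> liminf (\<lambda>T. ereal (V1 T / V T))"
proof -
  have "(\<lambda>T. inverse (V T / W T)) \<longlonglongrightarrow> inverse 1"
    by (intro tendsto_inverse V) simp
  then have "(\<lambda>T. ereal (W T / V T)) \<longlonglongrightarrow> ereal 1"
    by (intro tendsto_ereal) (simp add: inverse_divide)
  then have "liminf (\<lambda>T. ereal (W T / V T)) = 1"
    by (simp add: lim_imp_Liminf one_ereal_def)
  moreover have "\<forall>\<^sub>F T in sequentially. W T < 0"
    using W by (auto simp: filterlim_at_bot_dense)
  \<comment> \<open>Eventually \<open>W T < 0\<close> and \<open>V T / W T > 0\<close>, hence
    \<open>V T < 0\<close>, and dividing by it reverses \<open>V1 T \<le> W T\<close>. No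
    convergence of \<open>V1 T / V T\<close> is required, since the limit inferior is
    monotone.\<close>
  then have "\<forall>\<^sub>F T in sequentially. ereal (W T / V T) \<le> ereal (V1 T / V T)"
    using order_tendstoD(1)[OF V zero_less_one]
  proof eventually_elim
    case (elim T)
    then have "V T < 0"
      by (simp add: zero_less_divide_iff)
    then show ?case
      using le[of T] by (simp add: divide_right_mono_neg)
  qed
  then have "liminf (\<lambda>T. ereal (W T / V T)) \<le> liminf (\<lambda>T. ereal (V1 T / V T))"
    by (rule Liminf_mono)
  ultimately show ?thesis by simp
qed

theorem theorem2:
  fixes f U :: "real \<Rightarrow> real" and k0 :: real
    and kT cT :: "nat \<Rightarrow> nat \<Rightarrow> real"
    and k c k1 c1 :: "nat \<Rightarrow> real"
  assumes f: "production_function f"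
    and U: "utility_function U"
    and k0: "k0 > 0"
    and optimal: "\<And>T. finite_horizon_optimal f U k0 T (kT T) (cT T)"
    and lim_k: "\<And>t. (\<lambda>T. kT T t) \<longlonglongrightarrow> k t"
    and lim_c: "\<And>t. (\<lambda>T. cT T t) \<longlonglongrightarrow> c t"
    and neg: "\<And>t. U (c t) < 0"
    and infinite_value:
      "\<exists>L::ereal. \<bar>L\<bar> = \<infinity> \<and> (\<lambda>T. ereal (\<Sum>t\<le>T. U (cT T t))) \<longlonglongrightarrow> L"
    and relative_gap:
      "(\<lambda>T. ((\<Sum>t<T. U (cT T t) - U (c t)) + U (f (kT T T)) - U (f (k T)))
              / (\<Sum>t\<le>T. U (cT T t))) \<longlonglongrightarrow> 0"
    and feasible: "feasible_path f k0 k1 c1"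
    and neg1: "\<And>t. U (c1 t) < 0"
  shows "catches_up f U k0 k1 c1 k c"
proof -
  define W where "W T = (\<Sum>t\<le>T. U (cT T t))" for T
  define V where "V = converted_utility f U k c"
  have feas: "feasible_path f k0 k c"
  proof (rule feasible_path_limit[OF _ k0 _ lim_k lim_c])
    show "continuous_on {0..} f"
      using f unfolding production_function_def by blast
    show "finite_horizon_admissible f k0 T (kT T) (cT T)" for T
      using optimal[of T] unfolding finite_horizon_optimal_def by blast
  qed
  \<comment> \<open>Since \<open>W T\<close> is itself a converted utility, the numerator of
    condition (ii) is the utility gap at date \<open>T\<close>.\<close>
  have "(\<Sum>t<T. U (cT T t) - U (c t)) + U (f (kT T T)) - U (f (k T)) = W T - V T" for T
    unfolding W_def V_def finite_horizon_optimal_value[OF optimal] converted_utility_def sum_subtractf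
    by linarith
  then have gap: "(\<lambda>T. (W T - V T) / W T) \<longlonglongrightarrow> 0"
    using relative_gap unfolding W_def[symmetric] by simp
  have complement: "(\<lambda>T. 1 - (W T - V T) / W T) \<longlonglongrightarrow> 1"
    using tendsto_diff[OF tendsto_const gap, of 1] by simp
  obtain L :: ereal where L: "\<bar>L\<bar> = \<infinity>" "(\<lambda>T. ereal (W T)) \<longlonglongrightarrow> L"
    using infinite_value unfolding W_def[symmetric] by metis
  \<comment> \<open>Division by zero yields 0, so the identity
    \<open>1 - (W T - V T) / W T = V T / W T\<close> fails where \<open>W T = 0\<close>. An infinite
    limit excludes this for large \<open>T\<close>.\<close>
  then have W_nz: "\<forall>\<^sub>F T in sequentially. W T \<noteq> 0"
    using tendsto_imp_eventually_ne[OF L(2), of 0] by (cases L) (auto simp: zero_ereal_def)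
  then have "\<forall>\<^sub>F T in sequentially. 1 - (W T - V T) / W T = V T / W T"
    by eventually_elim (simp add: field_simps)
  then have ratio: "(\<lambda>T. V T / W T) \<longlonglongrightarrow> 1"
    by (rule Lim_transform_eventually[OF complement])
  have "L \<noteq> \<infinity>"
  proof
    assume "L = \<infinity>"
    then have "filterlim W at_top sequentially"
      using L(2) by (simp add: tendsto_PInfty_eq_at_top)
    \<comment> \<open>A ratio tending to 1 makes \<open>V\<close> inherit the divergence of
      \<open>W\<close>, against its upper bound.\<close>
    then have "filterlim (\<lambda>T. V T / W T * W T) at_top sequentially"
      by (rule filterlim_tendsto_pos_mult_at_top[OF ratio zero_less_one])
    moreover have "\<forall>\<^sub>F T in sequentially. V T / W T * W T = V T"
      using W_nz by eventually_elim simp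
    ultimately have V_top: "filterlim V at_top sequentially"
      by (simp cong: filterlim_cong)
    obtain B where "\<And>T. V T \<le> B"
      using converted_utility_bounded_above[OF f U k0 feas neg] unfolding V_def by blast
    moreover obtain T where "B < V T"
      using V_top unfolding filterlim_at_top_dense eventually_sequentially by blast
    ultimately show False
      by (meson not_le)
  qed
  then have "L = -\<infinity>"
    using L(1) by (cases L) auto
  then have "filterlim W at_bot sequentially"
    using L(2) by (simp add: tendsto_MInfty filterlim_at_bot_dense)
  moreover have "converted_utility f U k1 c1 T \<le> W T" for T
    unfolding W_def by (rule converted_utility_le_optimal[OF f k0 optimal feasible])
  ultimately have "1 \<le> liminf (\<lambda>T. ereal (converted_utility f U k1 c1 T / V T))"
    using ratio by (intro liminf_quotient_ge_1)
  then show ?thesis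
    using feasible feas neg neg1 unfolding catches_up_def V_def by blast
qed

end
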